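(* For all $\varepsilon\in(0,1)$ and $\delta>0$ there is an $L$ such that for all $\ell\ge L$ and all integers $0\le t\le\left(\frac{2}{\pi^2}-\delta\right)\ell^4\log\ell$, the vertex-driven grid shuffling Markov chain of Diaconis and Saloff-Coste on the $\ell\times\ell$ grid has, after $t$ steps and from a worst starting state, variation distance at least $1-\varepsilon$ from the uniform distribution. This holds both for the chain on arrangements of $\ell^2$ distinct cards and for the chain on arrangements of $\lfloor\ell^2/2\rfloor$ ones and $\ell^2-\lfloor\ell^2/2\rfloor$ zeros.
   Context: The $\ell\times\ell$ grid graph has vertices $(i,j)$, $1\le i,j\le\ell$, with edges between vertices at Euclidean distance 1. Each vertex carries one card: either all cards are distinct (the state is a bijection between cards and vertices), or there are $\lfloor\ell^2/2\rfloor$ cards labeled 1 and the rest are labeled 0. The vertex-driven chain: at each step pick a uniformly random vertex, pick a uniformly random edge incident to that vertex, and exchange the cards at the endpoints of that edge (so an edge $(u,v)$ is selected with probability proportional to $1/\deg(u)+1/\deg(v)$). The uniform distribution is stationary. Variation distance is total variation distance $\frac12\|\cdot\|_1$. $\log$ is the natural logarithm. *)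

theory Defs
  imports "HOL-Probability.Probability"
begin

type_synonym vertex = "nat \<times> nat"
type_synonym arrangement = "vertex \<Rightarrow> nat"

definition grid_vertices :: "nat \<Rightarrow> vertex set" where
  "grid_vertices l = {1..l} \<times> {1..l}"

text \<open>On \<^typ>\<open>real \<times> real\<close>, \<^const>\<open>dist\<close> is the Euclidean distance.\<close>

definition grid_edges :: "nat \<Rightarrow> vertex set set" where
  "grid_edges l =
    {{(i, j), (i', j')} | i j i' j'.
       (i, j) \<in> grid_vertices l \<and> (i', j') \<in> grid_vertices l \<and>
       dist (real i, real j) (real i', real j') = 1}"

definition incident_edges :: "nat \<Rightarrow> vertex \<Rightarrow> vertex set set" where
  "incident_edges l v = {e \<in> grid_edges l. v \<in> e}"

text \<open>For an edge \<open>e\<close> and \<open>x \<in> e\<close>, the set \<open>e - {x}\<close> consists of the other endpoint.\<close>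

definition exchange :: "vertex set \<Rightarrow> arrangement \<Rightarrow> arrangement" where
  "exchange e s = (\<lambda>x. if x \<in> e then s (the_elem (e - {x})) else s x)"

text \<open>
  The transition kernel is meaningful for \<open>l \<ge> 2\<close>, where every vertex has an incident edge;
  \<^const>\<open>pmf_of_set\<close> is unspecified on the empty set.
\<close>

definition vertex_driven_step :: "nat \<Rightarrow> arrangement \<Rightarrow> arrangement pmf" where
  "vertex_driven_step l s =
    bind_pmf (pmf_of_set (grid_vertices l)) (\<lambda>v.
    bind_pmf (pmf_of_set (incident_edges l v)) (\<lambda>e.
    return_pmf (exchange e s)))"

definition chain_dist :: "('s \<Rightarrow> 's pmf) \<Rightarrow> 's \<Rightarrow> nat \<Rightarrow> 's pmf" where
  "chain_dist K s t = ((\<lambda>p. bind_pmf p K) ^^ t) (return_pmf s)"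

definition variation_distance :: "'s pmf \<Rightarrow> 's pmf \<Rightarrow> real" where
  "variation_distance p q = (1/2) * (\<Sum>\<^sub>\<infinity>x. \<bar>pmf p x - pmf q x\<bar>)"

text \<open>
  Distance from uniform after \<open>t\<close> steps from a worst starting state,
  for a chain with finite nonempty state space \<open>S\<close>.
\<close>

definition worst_distance_from_uniform :: "('s \<Rightarrow> 's pmf) \<Rightarrow> 's set \<Rightarrow> nat \<Rightarrow> real" where
  "worst_distance_from_uniform K S t =
    (MAX s\<in>S. variation_distance (chain_dist K s t) (pmf_of_set S))"

text \<open>
  The arrangements are extensional (\<open>undefined\<close> off the grid), so that each arrangement of
  cards on the grid is represented by exactly one function.
\<close>

definition distinct_arrangements :: "nat \<Rightarrow> arrangement set" where
  "distinct_arrangements l =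
    {s \<in> grid_vertices l \<rightarrow>\<^sub>E {1..l^2}. bij_betw s (grid_vertices l) {1..l^2}}"

definition binary_arrangements :: "nat \<Rightarrow> arrangement set" where
  "binary_arrangements l =
    {s \<in> grid_vertices l \<rightarrow>\<^sub>E {0, 1}. card {v \<in> grid_vertices l. s v = 1} = l^2 div 2}"

end

theory Submission
  imports Defs "HOL-Combinatorics.Transposition" "HOL-Real_Asymp.Real_Asymp"
begin

text \<open>
  Following one card, the shuffle becomes a symmetric operator \<open>P\<close> on functions on the grid with
  \<open>0 \<le> P \<le> 1\<close>. The statistic \<open>\<langle>f, \<phi> \<circ> X\<^sub>t\<rangle>\<close>, with \<open>\<phi>\<close> the indicator of half of the cards and
  \<open>f (i, j) = cos (\<pi> (i - 1/2) / l)\<close>, has mean \<open>\<langle>P\<^sup>t f, \<phi> \<circ> X\<^sub>0\<rangle>\<close>, and a telescoping sum bounds its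
  variance by \<open>\<parallel>f\<parallel>\<^sup>2 = l\<^sup>2 / 2\<close> at all times. The boundary prevents \<open>f\<close> from being an eigenfunction,
  but convexity of the moments \<open>\<langle>f, P\<^sup>t f\<rangle>\<close> only asks for its Rayleigh quotient
  \<open>1 - \<pi>\<^sup>2 / (2 l\<^sup>4) (1 + O(1/l))\<close>. Starting from ones at the largest values of \<open>P\<^sup>t f\<close>, the mean at
  time \<open>t\<close> exceeds the standard deviation by a power of \<open>l\<close>, whereas the mean at equilibrium is \<open>0\<close>;
  Chebyshev's inequality separates the two distributions.
\<close>

subsection \<open>Random transpositions\<close>

text \<open>Exchanging cards along \<open>e\<close> is composition with this map of positions.
  Working on positions separates the random edge from the arrangement.\<close>

definition swap_along :: "'a set \<Rightarrow> 'a \<Rightarrow> 'a" where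
  "swap_along e x = (if x \<in> e then the_elem (e - {x}) else x)"

lemma swap_along_pair: "x \<noteq> y \<Longrightarrow> swap_along {x, y} = Transposition.transpose x y"
  by (auto simp: swap_along_def Transposition.transpose_def fun_eq_iff insert_Diff_if)

text \<open>The share of one edge in the polarized Dirichlet form. Summing over ordered pairs and
  halving avoids orienting \<open>e\<close>.\<close>

definition edge_form :: "'a set \<Rightarrow> ('a \<Rightarrow> real) \<Rightarrow> ('a \<Rightarrow> real) \<Rightarrow> real" where
  "edge_form e g h = (\<Sum>x\<in>e. \<Sum>y\<in>e. (g x - g y) * (h x - h y)) / 2"

lemma edge_form_pair: "x \<noteq> y \<Longrightarrow> edge_form {x, y} g h = (g x - g y) * (h x - h y)"
  by (simp add: edge_form_def field_simps)

lemma edge_form_commute: "edge_form e g h = edge_form e h g"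
  by (simp add: edge_form_def mult.commute)

lemma edge_form_nonneg: "edge_form e g g \<ge> 0"
  by (auto simp: edge_form_def intro!: sum_nonneg)

lemma expectation_bind_pmf_finite:
  fixes h :: "'b \<Rightarrow> real"
  assumes "finite (set_pmf p)" and "\<And>x. x \<in> set_pmf p \<Longrightarrow> finite (set_pmf (K x))"
  shows "measure_pmf.expectation (bind_pmf p K) h =
    measure_pmf.expectation p (\<lambda>x. measure_pmf.expectation (K x) h)"
  using assms
  by (subst pmf_expectation_bind[of "set_pmf p"])
     (auto simp: integral_measure_pmf_real[of "set_pmf p"] mult.commute)

text \<open>\<open>lazy\<close> says that each position keeps its card with probability at least
  1/2. This makes the one-card operator positive semidefinite, on which both the variance bound and
  the odd moments rest.\<close>

locale random_swaps =
  fixes V :: "'a set" and \<mu> :: "'a set pmf"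
  assumes finite_V: "finite V"
    and finite_swaps: "finite (set_pmf \<mu>)"
    and swaps_pair: "e \<in> set_pmf \<mu> \<Longrightarrow> \<exists>x\<in>V. \<exists>y\<in>V. x \<noteq> y \<and> e = {x, y}"
    and lazy: "x \<in> V \<Longrightarrow> measure_pmf.prob \<mu> {e. x \<in> e} \<le> 1 / 2"
begin

abbreviation avg :: "('a set \<Rightarrow> real) \<Rightarrow> real" where
  "avg F \<equiv> measure_pmf.expectation \<mu> F"

section \<open>The one-card operator and its Dirichlet form\<close>

definition ip :: "('a \<Rightarrow> real) \<Rightarrow> ('a \<Rightarrow> real) \<Rightarrow> real" where
  "ip g h = (\<Sum>x\<in>V. g x * h x)"

definition P :: "('a \<Rightarrow> real) \<Rightarrow> 'a \<Rightarrow> real" where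
  "P g x = avg (\<lambda>e. g (swap_along e x))"

lemma integrable_swaps [simp]: "integrable (measure_pmf \<mu>) (F :: 'a set \<Rightarrow> real)"
  by (rule integrable_measure_pmf_finite[OF finite_swaps])

lemma avg_mono: "(\<And>e. e \<in> set_pmf \<mu> \<Longrightarrow> F e \<le> G e) \<Longrightarrow> avg F \<le> avg G"
  by (intro integral_mono_AE) (auto simp: AE_measure_pmf_iff)

lemma avg_cong: "(\<And>e. e \<in> set_pmf \<mu> \<Longrightarrow> F e = G e) \<Longrightarrow> avg F = avg G"
  by (intro integral_cong_AE) (auto simp: AE_measure_pmf_iff)

lemma ip_commute: "ip g h = ip h g"
  by (simp add: ip_def mult.commute)

lemma ip_diff_right: "ip g (\<lambda>x. h x - c * k x) = ip g h - c * ip g k"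
  by (simp add: ip_def algebra_simps sum_subtractf sum_distrib_left)

lemma ip_diff_left: "ip (\<lambda>x. h x - c * k x) g = ip h g - c * ip k g"
  by (simp add: ip_def algebra_simps sum_subtractf sum_distrib_left)

text \<open>Only the summands at the two endpoints change, and their total change factors into a
  product of differences.\<close>

lemma ip_swap_along:
  assumes "e \<in> set_pmf \<mu>"
  shows "ip g (\<lambda>x. h (swap_along e x)) = ip g h - edge_form e g h"
proof -
  obtain x y where xy: "x \<in> V" "y \<in> V" "x \<noteq> y" "e = {x, y}"
    using swaps_pair[OF assms] by blast
  have "ip g h - ip g (\<lambda>x. h (swap_along e x)) = (\<Sum>v\<in>V. g v * (h v - h (Transposition.transpose x y v)))"
    using xy by (simp add: ip_def swap_along_pair sum_subtractf algebra_simps)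
  also have "\<dots> = (\<Sum>v\<in>{x, y}. g v * (h v - h (Transposition.transpose x y v)))"
    using xy finite_V by (intro sum.mono_neutral_right) (auto simp: Transposition.transpose_def)
  also have "\<dots> = edge_form e g h"
    using xy by (simp add: edge_form_pair algebra_simps)
  finally show ?thesis by simp
qed

text \<open>Averaging over the edge identifies the quadratic form of \<open>1 - P\<close>;
  self-adjointness and \<open>P \<le> 1\<close> can then be read off edge by edge.\<close>

lemma ip_P: "ip g (P h) = ip g h - avg (\<lambda>e. edge_form e g h)"
proof -
  have "ip g (P h) = avg (\<lambda>e. ip g (\<lambda>x. h (swap_along e x)))"
    by (simp add: ip_def P_def)
  also have "\<dots> = avg (\<lambda>e. ip g h - edge_form e g h)"
    by (intro avg_cong ip_swap_along)
  finally show ?thesis by simp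
qed

lemma ip_P_commute: "ip g (P h) = ip (P g) h"
  using ip_P[of g h] ip_P[of h g] by (simp add: ip_commute edge_form_commute)

lemma ip_P_le: "ip g (P g) \<le> ip g g"
  by (simp add: ip_P edge_form_nonneg)

text \<open>By \<open>(a - b)^2 \<le> 2 * a^2 + 2 * b^2\<close> each edge is charged to its
  endpoints, and laziness bounds the charge of \<open>x\<close> by \<open>(g x)^2\<close>. Hence the
  Dirichlet form is at most \<open>ip g g\<close>.\<close>

lemma ip_P_nonneg: "0 \<le> ip g (P g)"
proof -
  have "avg (\<lambda>e. edge_form e g g) \<le> avg (\<lambda>e. \<Sum>x\<in>V. 2 * (g x)\<^sup>2 * indicator {e. x \<in> e} e)"
  proof (rule avg_mono)
    fix e assume "e \<in> set_pmf \<mu>"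
    then obtain x y where xy: "x \<in> V" "y \<in> V" "x \<noteq> y" "e = {x, y}"
      using swaps_pair by blast
    have "edge_form e g g = (g x - g y)\<^sup>2"
      using xy by (simp add: edge_form_pair power2_eq_square)
    also have "\<dots> \<le> 2 * (g x)\<^sup>2 + 2 * (g y)\<^sup>2"
      using zero_le_power2[of "g x + g y"] by (simp add: power2_eq_square algebra_simps)
    also have "\<dots> = (\<Sum>v\<in>{x, y}. 2 * (g v)\<^sup>2 * indicator {e. v \<in> e} e)"
      using xy by simp
    also have "\<dots> = (\<Sum>v\<in>V. 2 * (g v)\<^sup>2 * indicator {e. v \<in> e} e)"
      using xy finite_V by (intro sum.mono_neutral_left) auto
    finally show "edge_form e g g \<le> (\<Sum>v\<in>V. 2 * (g v)\<^sup>2 * indicator {e. v \<in> e} e)" .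
  qed
  also have "\<dots> = (\<Sum>x\<in>V. 2 * (g x)\<^sup>2 * measure_pmf.prob \<mu> {e. x \<in> e})"
    by simp
  also have "\<dots> \<le> (\<Sum>x\<in>V. 2 * (g x)\<^sup>2 * (1 / 2))"
    by (intro sum_mono mult_left_mono lazy) auto
  also have "\<dots> = ip g g"
    by (simp add: ip_def power2_eq_square)
  finally show ?thesis by (simp add: ip_P)
qed

text \<open>The operator identity \<open>P - P\<^sup>2 = P (1 - P) P + (1 - P) P (1 - P)\<close>.\<close>

lemma ip_P_P_le: "ip (P g) (P g) \<le> ip g (P g)"
proof -
  \<comment> \<open>Here \<open>r = (1 - P) g\<close>; the factor 1 matches the form of
    \<open>ip_diff_right\<close> and \<open>ip_diff_left\<close>. Positivity of \<open>P\<close> at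
    \<open>r\<close> and \<open>P \<le> 1\<close> at \<open>P g\<close> give the two terms of the
    identity.\<close>
  define r where "r = (\<lambda>x. g x - 1 * P g x)"
  have Pr: "P r x = P g x - 1 * P (P g) x" for x
    by (simp add: r_def P_def[of "\<lambda>x. g x - 1 * P g x"]) (simp add: P_def)
  have "0 \<le> ip r (P r)"
    by (rule ip_P_nonneg)
  also have "ip r (P r) = ip r (\<lambda>x. P g x - 1 * P (P g) x)"
    by (simp add: ip_def Pr)
  also have "\<dots> = ip g (P g) - 2 * ip (P g) (P g) + ip (P g) (P (P g))"
    unfolding ip_diff_right unfolding r_def ip_diff_left
    using ip_P_commute[of g "P g"] by simp
  finally show ?thesis
    using ip_P_le[of "P g"] by simp
qed

lemma ip_funpow_P: "ip ((P ^^ i) g) ((P ^^ j) g) = ip g ((P ^^ (i + j)) g)"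
proof (induction i arbitrary: j)
  case (Suc i)
  have "ip ((P ^^ Suc i) g) ((P ^^ j) g) = ip ((P ^^ i) g) ((P ^^ Suc j) g)"
    by (simp add: ip_P_commute)
  also have "\<dots> = ip g ((P ^^ (Suc i + j)) g)"
    using Suc.IH[of "Suc j"] by simp
  finally show ?case .
qed simp

text \<open>
  Jensen's inequality for the spectral measure of \<open>g\<close>: the moments \<open>a t = \<langle>g, P\<^sup>t g\<rangle>\<close> satisfy
  \<open>a (t + 2) - 2 \<rho> a (t + 1) + \<rho>\<^sup>2 a t \<ge> 0\<close>.
\<close>

lemma ip_funpow_P_ge:
  assumes \<rho>: "\<rho> \<ge> 0" "\<rho> * ip g g \<le> ip g (P g)"
  shows "ip g ((P ^^ t) g) \<ge> \<rho> ^ t * ip g g"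
proof -
  define a where "a t = ip g ((P ^^ t) g)" for t
  have a: "ip ((P ^^ i) g) ((P ^^ j) g) = a (i + j)" for i j
    by (simp add: ip_funpow_P a_def)
  have second_diff: "a (t + 2) - 2 * \<rho> * a (t + 1) + \<rho>\<^sup>2 * a t \<ge> 0" for t
  proof -
    \<comment> \<open>\<open>r k\<close> is \<open>P^k (P - \<rho>) g\<close>. The second difference
      at \<open>t\<close> is a squared norm of some \<open>r k\<close> when \<open>t\<close> is
      even, and \<open>ip (r k) (P (r k))\<close> when \<open>t\<close> is odd.\<close>
    define r where "r k x = (P ^^ Suc k) g x - \<rho> * (P ^^ k) g x" for k x
    have Pr: "P (r k) = r (Suc k)" for k
      by (rule ext) (simp add: r_def P_def[of "r k"], simp add: P_def)
    have ip_r: "ip (r i) (r j) = a (i + j + 2) - 2 * \<rho> * a (i + j + 1) + \<rho>\<^sup>2 * a (i + j)" for i j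
      using a[of "Suc i" "Suc j"] a[of "Suc i" j] a[of i "Suc j"] a[of i j]
      unfolding r_def ip_diff_right ip_diff_left
      by (simp add: algebra_simps power2_eq_square)
    have even_case: "ip (r k) (r k) \<ge> 0" for k
      by (auto simp: ip_def intro!: sum_nonneg)
    have odd_case: "ip (r k) (r (Suc k)) \<ge> 0" for k
      using ip_P_nonneg[of "r k"] by (simp add: Pr)
    show ?thesis
    proof (cases "even t")
      case True
      then obtain k where "t = k + k" by (metis evenE mult_2)
      then show ?thesis using even_case[of k] ip_r[of k k] by simp
    next
      case False
      then obtain k where "t = k + Suc k" by (metis oddE mult_2 add_Suc_right Suc_eq_plus1)
      then show ?thesis using odd_case[of k] ip_r[of k "Suc k"] by simp
    qed
  qed
  \<comment> \<open>The ratio bound propagates without dividing by moments: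
    \<open>a (t + 2) \<ge> 2 * \<rho> * a (t + 1) - \<rho>^2 * a t\<close>, and the induction
    hypothesis bounds the last term by \<open>\<rho> * a (t + 1)\<close>.\<close>
  have step: "\<rho> * a t \<le> a (Suc t)" for t
  proof (induction t)
    case 0
    then show ?case using \<rho> by (simp add: a_def)
  next
    case (Suc t)
    have "\<rho> * (\<rho> * a t) \<le> \<rho> * a (Suc t)"
      using Suc \<rho> by (intro mult_left_mono) auto
    then show ?case
      using second_diff[of t] by (simp add: power2_eq_square)
  qed
  have "\<rho> ^ t * a 0 \<le> a t"
  proof (induction t)
    case (Suc t)
    have "\<rho> * (\<rho> ^ t * a 0) \<le> \<rho> * a t"
      using Suc \<rho> by (intro mult_left_mono) auto
    then show ?case
      using step[of t] by simp
  qed simp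
  then show ?thesis by (simp add: a_def)
qed

text \<open>Edge forms vanish on constants. Later this keeps the sum of \<open>P^t f\<close> at
  zero, so that constant parts of a configuration do not contribute to the mean.\<close>

lemma sum_P: "(\<Sum>x\<in>V. P g x) = (\<Sum>x\<in>V. g x)"
  using ip_P[of "\<lambda>_. 1" g] by (simp add: ip_def edge_form_def)

lemma sum_funpow_P: "(\<Sum>x\<in>V. (P ^^ t) g x) = (\<Sum>x\<in>V. g x)"
  by (induction t) (simp_all add: sum_P)

section \<open>The chain on arrangements and the variance of linear statistics\<close>

definition K :: "('a \<Rightarrow> 'b) \<Rightarrow> ('a \<Rightarrow> 'b) pmf" where
  "K s = map_pmf (\<lambda>e x. s (swap_along e x)) \<mu>"

lemma finite_set_K [simp]: "finite (set_pmf (K s))"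
  by (simp add: K_def finite_swaps)

lemma finite_set_chain_dist [simp]: "finite (set_pmf (chain_dist K s t))"
  by (induction t) (simp_all add: chain_dist_def)

lemma expectation_chain_dist_Suc:
  fixes h :: "_ \<Rightarrow> real"
  shows "measure_pmf.expectation (chain_dist K s (Suc t)) h =
    measure_pmf.expectation (chain_dist K s t) (\<lambda>s'. measure_pmf.expectation (K s') h)"
  using expectation_bind_pmf_finite[OF finite_set_chain_dist finite_set_K, where h = h]
  by (simp add: chain_dist_def)

text \<open>Given \<open>s\<close>, the statistic drops by \<open>edge_form e g u\<close>, which
  moves its mean to \<open>ip (P g) u\<close>. Since \<open>\<phi>\<close> takes values in [0,1],
  the squared jump is at most \<open>edge_form e g g\<close>, whose average is
  \<open>ip g g - ip g (P g)\<close>.\<close>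

lemma expectation_K_square_le:
  fixes \<phi> :: "'b \<Rightarrow> real"
  assumes \<phi>: "\<And>y. 0 \<le> \<phi> y \<and> \<phi> y \<le> 1"
  shows "measure_pmf.expectation (K s) (\<lambda>s. (ip g (\<lambda>x. \<phi> (s x)) - m)\<^sup>2) \<le>
    ip g g - ip g (P g) + (ip (P g) (\<lambda>x. \<phi> (s x)) - m)\<^sup>2"
proof -
  define u where "u = (\<lambda>x. \<phi> (s x))"
  have avg_form: "avg (\<lambda>e. edge_form e g u) = ip g u - ip (P g) u"
    using ip_P[of g u] by (simp add: ip_P_commute)
  have form_sq: "(edge_form e g u)\<^sup>2 \<le> edge_form e g g" if e: "e \<in> set_pmf \<mu>" for e
  proof -
    obtain x y where xy: "x \<noteq> y" "e = {x, y}"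
      using swaps_pair[OF e] by blast
    have "\<bar>u x - u y\<bar> \<le> 1"
      using \<phi>[of "s x"] \<phi>[of "s y"] by (auto simp: u_def)
    then have "(u x - u y)\<^sup>2 \<le> 1"
      by (simp add: abs_square_le_1)
    then have "(g x - g y)\<^sup>2 * (u x - u y)\<^sup>2 \<le> (g x - g y)\<^sup>2 * 1"
      by (intro mult_left_mono) auto
    then show ?thesis
      using xy by (simp add: edge_form_pair power2_eq_square algebra_simps)
  qed
  have "measure_pmf.expectation (K s) (\<lambda>s. (ip g (\<lambda>x. \<phi> (s x)) - m)\<^sup>2) =
      avg (\<lambda>e. (ip g (\<lambda>x. u (swap_along e x)) - m)\<^sup>2)"
    by (simp add: K_def u_def)
  also have "\<dots> = avg (\<lambda>e. (ip g u - m)\<^sup>2 - 2 * (ip g u - m) * edge_form e g u + (edge_form e g u)\<^sup>2)"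
    by (intro avg_cong) (simp add: ip_swap_along power2_eq_square algebra_simps)
  also have "\<dots> = (ip g u - m)\<^sup>2 - 2 * (ip g u - m) * avg (\<lambda>e. edge_form e g u) + avg (\<lambda>e. (edge_form e g u)\<^sup>2)"
    by simp
  also have "\<dots> \<le> (ip g u - m)\<^sup>2 - 2 * (ip g u - m) * (ip g u - ip (P g) u) + avg (\<lambda>e. edge_form e g g)"
    unfolding avg_form by (intro add_left_mono avg_mono form_sq)
  \<comment> \<open>Completing the square discards the squared mean of the jump.\<close>
  also have "\<dots> \<le> avg (\<lambda>e. edge_form e g g) + (ip (P g) u - m)\<^sup>2"
    using zero_le_power2[of "ip g u - ip (P g) u"] by (simp add: power2_eq_square algebra_simps)
  finally show ?thesis
    by (simp add: ip_P u_def)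
qed

text \<open>Peeling off the last step replaces \<open>g\<close> by \<open>P g\<close> and keeps the
  center, hence the induction for all \<open>g\<close>. The new variance
  \<open>ip g g - ip g (P g)\<close> and the inherited \<open>ip (P g) (P g)\<close> add up to at
  most \<open>ip g g\<close>, by \<open>ip_P_P_le\<close>.\<close>

lemma chain_dist_variance_le:
  fixes \<phi> :: "'b \<Rightarrow> real"
  assumes \<phi>: "\<And>y. 0 \<le> \<phi> y \<and> \<phi> y \<le> 1"
  shows "measure_pmf.expectation (chain_dist K s t)
    (\<lambda>s'. (ip g (\<lambda>x. \<phi> (s' x)) - ip ((P ^^ t) g) (\<lambda>x. \<phi> (s x)))\<^sup>2) \<le> ip g g"
proof (induction t arbitrary: g)
  case 0
  show ?case by (auto simp add: chain_dist_def ip_def intro!: sum_nonneg)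
next
  case (Suc t)
  define m where "m = ip ((P ^^ Suc t) g) (\<lambda>x. \<phi> (s x))"
  let ?E = "measure_pmf.expectation (chain_dist K s t)"
  have int: "integrable (measure_pmf (chain_dist K s t)) F" for F :: "_ \<Rightarrow> real"
    by (rule integrable_measure_pmf_finite) simp
  have "measure_pmf.expectation (chain_dist K s (Suc t)) (\<lambda>s'. (ip g (\<lambda>x. \<phi> (s' x)) - m)\<^sup>2)
      \<le> ?E (\<lambda>s'. ip g g - ip g (P g) + (ip (P g) (\<lambda>x. \<phi> (s' x)) - m)\<^sup>2)"
    unfolding expectation_chain_dist_Suc
    by (intro integral_mono int expectation_K_square_le \<phi>)
  also have "\<dots> = ip g g - ip g (P g) + ?E (\<lambda>s'. (ip (P g) (\<lambda>x. \<phi> (s' x)) - m)\<^sup>2)"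
    by (simp add: int)
  also have "\<dots> \<le> ip g g - ip g (P g) + ip (P g) (P g)"
    using Suc.IH[of "P g"] by (simp add: m_def funpow_swap1)
  also have "\<dots> \<le> ip g g"
    using ip_P_P_le[of g] by simp
  finally show ?case by (simp add: m_def)
qed

end

subsection \<open>Separation by second moments\<close>

text \<open>Chebyshev at the threshold \<open>m / 2\<close>: the event \<open>F > m / 2\<close> has
  probability at least \<open>1 - 4 * v / m^2\<close> under \<open>p\<close> and at most
  \<open>4 * w / m^2\<close> under \<open>q\<close>.\<close>

lemma variation_distance_ge_moments:
  fixes F :: "'s \<Rightarrow> real"
  assumes fin: "finite (set_pmf p)" "finite (set_pmf q)"
    and p: "measure_pmf.expectation p (\<lambda>s. (F s - m)\<^sup>2) \<le> v"
    and q: "measure_pmf.expectation q (\<lambda>s. (F s)\<^sup>2) \<le> w"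
    and m: "m > 0"
  shows "variation_distance p q \<ge> 1 - 4 * (v + w) / m\<^sup>2"
proof -
  define D where "D = set_pmf p \<union> set_pmf q"
  define I :: "'s \<Rightarrow> real" where "I s = (if F s > m / 2 then 1 else 0)" for s
  have finD: "finite D" using fin by (simp add: D_def)
  have expect: "measure_pmf.expectation p h = (\<Sum>s\<in>D. h s * pmf p s)"
      "measure_pmf.expectation q h = (\<Sum>s\<in>D. h s * pmf q s)" for h :: "'s \<Rightarrow> real"
    using finD by (auto simp: D_def intro!: integral_measure_pmf_real)
  have total: "(\<Sum>s\<in>D. pmf p s) = 1" "(\<Sum>s\<in>D. pmf q s) = 1"
    using finD by (auto simp: D_def intro!: sum_pmf_eq_1)
  have "measure_pmf.expectation p (\<lambda>s. 1 - I s) \<le> measure_pmf.expectation p (\<lambda>s. 4 / m\<^sup>2 * (F s - m)\<^sup>2)"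
  proof (intro integral_mono integrable_measure_pmf_finite fin)
    fix s
    show "1 - I s \<le> 4 / m\<^sup>2 * (F s - m)\<^sup>2"
    proof (cases "F s > m / 2")
      case False
      then have "(m / 2)\<^sup>2 \<le> (m - F s)\<^sup>2" using m by (intro power_mono) auto
      then show ?thesis
        using False m by (simp add: I_def field_simps power2_commute power_divide)
    qed (simp add: I_def)
  qed
  also have "\<dots> \<le> 4 / m\<^sup>2 * v"
    using p by (simp add: divide_right_mono)
  finally have Ip: "1 - (\<Sum>s\<in>D. I s * pmf p s) \<le> 4 / m\<^sup>2 * v"
    by (simp add: expect algebra_simps sum_subtractf total)
  have "measure_pmf.expectation q I \<le> measure_pmf.expectation q (\<lambda>s. 4 / m\<^sup>2 * (F s)\<^sup>2)"
  proof (intro integral_mono integrable_measure_pmf_finite fin)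
    fix s
    show "I s \<le> 4 / m\<^sup>2 * (F s)\<^sup>2"
    proof (cases "F s > m / 2")
      case True
      then have "(m / 2)\<^sup>2 \<le> (F s)\<^sup>2" using m by (intro power_mono) auto
      then show ?thesis
        using True m by (simp add: I_def field_simps power_divide)
    qed (simp add: I_def)
  qed
  also have "\<dots> \<le> 4 / m\<^sup>2 * w"
    using q by (simp add: divide_right_mono)
  finally have Iq: "(\<Sum>s\<in>D. I s * pmf q s) \<le> 4 / m\<^sup>2 * w"
    by (simp add: expect)
  \<comment> \<open>Both masses are 1, so subtracting 1/2 from \<open>I\<close> changes nothing, and
    \<open>\<bar>I s - 1/2\<bar> = 1/2\<close> produces the factor in the variation
    distance.\<close>
  have "(\<Sum>s\<in>D. I s * pmf p s) - (\<Sum>s\<in>D. I s * pmf q s)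
      = (\<Sum>s\<in>D. (I s - 1 / 2) * (pmf p s - pmf q s))"
    using total by (simp add: algebra_simps sum_subtractf sum.distrib flip: sum_divide_distrib)
  also have "\<dots> \<le> (\<Sum>s\<in>D. 1 / 2 * \<bar>pmf p s - pmf q s\<bar>)"
  proof (rule sum_mono)
    fix s
    have "\<bar>I s - 1 / 2\<bar> = 1 / 2" by (simp add: I_def)
    then show "(I s - 1 / 2) * (pmf p s - pmf q s) \<le> 1 / 2 * \<bar>pmf p s - pmf q s\<bar>"
      by (metis abs_ge_self abs_mult)
  qed
  also have "\<dots> = variation_distance p q"
  proof -
    have "(\<Sum>\<^sub>\<infinity>s. \<bar>pmf p s - pmf q s\<bar>) = (\<Sum>\<^sub>\<infinity>s\<in>D. \<bar>pmf p s - pmf q s\<bar>)"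
      by (intro infsum_cong_neutral) (auto simp: D_def set_pmf_iff)
    then show ?thesis
      using finD by (simp add: variation_distance_def sum_distrib_left)
  qed
  finally show ?thesis
    using Ip Iq by (simp add: algebra_simps add_divide_distrib)
qed

text \<open>
  Writing \<open>Y s x\<close> for the centered value of the card at \<open>x\<close>, invariance under the transpositions
  fixing \<open>x\<close> makes the correlation of \<open>Y s x\<close> with \<open>Y s y\<close> the same for all \<open>y \<noteq> x\<close>, and
  \<open>\<Sum>y. Y s y = 0\<close> then determines it.
\<close>

lemma uniform_second_moment_le:
  fixes S :: "('a \<Rightarrow> 'b) set" and \<phi> :: "'b \<Rightarrow> real"
  assumes finS: "finite S" "S \<noteq> {}" and V: "finite V" "card V \<ge> 2"
    and closed: "\<And>s y z. s \<in> S \<Longrightarrow> y \<in> V \<Longrightarrow> z \<in> V \<Longrightarrow> s \<circ> Transposition.transpose y z \<in> S"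
    and sum_\<phi>: "\<And>s. s \<in> S \<Longrightarrow> (\<Sum>x\<in>V. \<phi> (s x)) = k"
    and \<phi>: "\<And>y. 0 \<le> \<phi> y \<and> \<phi> y \<le> 1"
    and sum_g: "(\<Sum>x\<in>V. g x) = 0"
  shows "measure_pmf.expectation (pmf_of_set S) (\<lambda>s. (\<Sum>x\<in>V. g x * \<phi> (s x))\<^sup>2)
    \<le> 2 * (\<Sum>x\<in>V. g x * g x)"
proof -
  define n where "n = real (card V)"
  have n: "n \<ge> 2" using V by (simp add: n_def)
  define Y where "Y s x = \<phi> (s x) - k / n" for s :: "'a \<Rightarrow> 'b" and x
  obtain s0 where "s0 \<in> S" using finS by blast
  then have "0 \<le> k" "k \<le> n"
    using sum_\<phi>[of s0] \<phi> sum_mono[of V "\<lambda>x. \<phi> (s0 x)" "\<lambda>_. 1"] sum_nonneg[of V "\<lambda>x. \<phi> (s0 x)"]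
    by (auto simp: n_def)
  then have kn: "0 \<le> k / n" "k / n \<le> 1" using n by auto
  have Y_le: "Y s x * Y s x \<le> 1" for s x
  proof -
    have "\<bar>Y s x\<bar> \<le> 1" using kn \<phi>[of "s x"] by (auto simp: Y_def)
    then show ?thesis by (simp add: abs_square_le_1 flip: power2_eq_square)
  qed
  have sum_Y: "(\<Sum>x\<in>V. Y s x) = 0" if "s \<in> S" for s
    using sum_\<phi>[OF that] n by (simp add: Y_def sum_subtractf n_def)
  have g_Y: "(\<Sum>x\<in>V. g x * \<phi> (s x)) = (\<Sum>x\<in>V. g x * Y s x)" for s
    using sum_g by (simp add: Y_def algebra_simps sum_subtractf flip: sum_divide_distrib sum_distrib_left)
  define T where "T x y = (\<Sum>s\<in>S. Y s x * Y s y)" for x y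
  have T_eq: "T x y = T x z" if "y \<in> V" "z \<in> V" "y \<noteq> x" "z \<noteq> x" for x y z
  proof -
    let ?c = "\<lambda>s. s \<circ> Transposition.transpose y z"
    show ?thesis
      unfolding T_def
    proof (rule sum.reindex_bij_witness[of _ ?c ?c])
      fix s assume "s \<in> S"
      then show "?c s \<in> S" using closed that by blast
    qed (use that closed in \<open>auto simp: fun_eq_iff Y_def\<close>)
  qed
  have T_sum: "(\<Sum>y\<in>V. T x y) = 0" for x
  proof -
    have "(\<Sum>y\<in>V. T x y) = (\<Sum>s\<in>S. Y s x * (\<Sum>y\<in>V. Y s y))"
      unfolding T_def by (subst sum.swap) (simp add: sum_distrib_left)
    then show ?thesis by (simp add: sum_Y)
  qed
  have T_off: "T x y = - T x x / (n - 1)" if "x \<in> V" "y \<in> V" "y \<noteq> x" for x y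
  proof -
    have "0 = T x x + (\<Sum>z\<in>V - {x}. T x z)"
      using T_sum[of x] that V by (simp add: sum.remove[of V x])
    also have "(\<Sum>z\<in>V - {x}. T x z) = (\<Sum>z\<in>V - {x}. T x y)"
      using that by (intro sum.cong refl T_eq) auto
    also have "\<dots> = (n - 1) * T x y"
      using that V by (simp add: n_def of_nat_diff)
    finally show ?thesis using n by (simp add: field_simps)
  qed
  \<comment> \<open>As \<open>g\<close> sums to zero, the off-diagonal terms add up to
    \<open>g x * T x x / (n - 1)\<close>: the quadratic form becomes diagonal.\<close>
  have inner: "(\<Sum>y\<in>V. g y * T x y) = g x * T x x * (n / (n - 1))" if "x \<in> V" for x
  proof -
    have "(\<Sum>y\<in>V. g y * T x y) = g x * T x x + (\<Sum>y\<in>V - {x}. g y * T x y)"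
      using that V by (simp add: sum.remove[of V x])
    also have "(\<Sum>y\<in>V - {x}. g y * T x y) = (\<Sum>y\<in>V - {x}. g y * (- T x x / (n - 1)))"
      using that by (intro sum.cong) (auto simp: T_off)
    also have "\<dots> = (\<Sum>y\<in>V - {x}. g y) * (- T x x / (n - 1))"
      by (rule sum_distrib_right[symmetric])
    also have "(\<Sum>y\<in>V - {x}. g y) = - g x"
      using sum_g that V by (simp add: sum.remove[of V x])
    finally show ?thesis using n by (simp add: field_simps)
  qed
  have "(\<Sum>s\<in>S. (\<Sum>x\<in>V. g x * Y s x)\<^sup>2) = (\<Sum>s\<in>S. \<Sum>x\<in>V. \<Sum>y\<in>V. g x * (g y * (Y s x * Y s y)))"
    by (simp add: power2_eq_square sum_product algebra_simps)
  also have "\<dots> = (\<Sum>x\<in>V. \<Sum>y\<in>V. \<Sum>s\<in>S. g x * (g y * (Y s x * Y s y)))"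
    by (subst sum.swap, rule sum.cong[OF refl], rule sum.swap)
  also have "\<dots> = (\<Sum>x\<in>V. g x * (\<Sum>y\<in>V. g y * T x y))"
    by (simp add: T_def sum_distrib_left)
  also have "\<dots> = (\<Sum>x\<in>V. g x * g x * (T x x * (n / (n - 1))))"
    by (intro sum.cong) (auto simp: inner)
  also have "\<dots> \<le> (\<Sum>x\<in>V. g x * g x * (real (card S) * 2))"
  proof (intro sum_mono mult_left_mono mult_mono)
    fix x
    show "T x x \<le> real (card S)"
      using sum_mono[of S "\<lambda>s. Y s x * Y s x" "\<lambda>_. 1"] Y_le by (simp add: T_def)
    \<comment> \<open>This is the source of the factor 2 in the bound.\<close>
    show "n / (n - 1) \<le> 2" "0 \<le> n / (n - 1)" using n by (auto simp: field_simps)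
  qed auto
  also have "\<dots> = real (card S) * (2 * (\<Sum>x\<in>V. g x * g x))"
    by (simp add: sum_distrib_left sum_distrib_right algebra_simps)
  finally show ?thesis
    using finS by (simp add: integral_pmf_of_set g_Y divide_le_eq card_gt_0_iff mult.commute)
qed

section \<open>Choice of the starting configuration\<close>

lemma exists_largest_values:
  fixes h :: "'a \<Rightarrow> real"
  assumes "finite V" "k \<le> card V"
  shows "\<exists>A\<subseteq>V. card A = k \<and> (\<forall>a\<in>A. \<forall>b\<in>V - A. h b \<le> h a)"
  using assms(2)
proof (induction k)
  case 0
  show ?case by (rule exI[of _ "{}"]) simp
next
  case (Suc k)
  then obtain A where A: "A \<subseteq> V" "card A = k" "\<forall>a\<in>A. \<forall>b\<in>V - A. h b \<le> h a"
    by auto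
  have finA: "finite A" using A assms finite_subset by blast
  have "V - A \<noteq> {}"
    using A Suc.prems card_mono[OF finA, of V] by auto
  then have "Max (h ` (V - A)) \<in> h ` (V - A)"
    using assms by (intro Max_in) auto
  then obtain c where c: "c \<in> V - A" "h c = Max (h ` (V - A))" by auto
  have c_max: "h b \<le> h c" if "b \<in> V - A" for b
    using that assms c by auto
  have "insert c A \<subseteq> V \<and> card (insert c A) = Suc k \<and>
      (\<forall>a\<in>insert c A. \<forall>b\<in>V - insert c A. h b \<le> h a)"
    using A c finA c_max by auto
  then show ?case by blast
qed

text \<open>The bathtub principle. For a threshold \<theta> separating the \<open>k\<close> largest
  values from the others, every term \<open>(indicator A x - w x) * (h x - \<theta>)\<close> is
  nonnegative, and \<theta> cancels because \<open>A\<close> and \<open>w\<close> have equal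
  mass.\<close>

lemma exists_subset_sum_ge:
  fixes h w :: "'a \<Rightarrow> real"
  assumes V: "finite V" and w: "\<And>x. x \<in> V \<Longrightarrow> 0 \<le> w x \<and> w x \<le> 1"
    and sum_w: "(\<Sum>x\<in>V. w x) = real k"
  shows "\<exists>A\<subseteq>V. card A = k \<and> (\<Sum>x\<in>V. w x * h x) \<le> (\<Sum>x\<in>A. h x)"
proof -
  have "real k \<le> real (card V)"
    using sum_mono[of V w "\<lambda>_. 1"] w sum_w by simp
  then obtain A where A: "A \<subseteq> V" "card A = k" "\<forall>a\<in>A. \<forall>b\<in>V - A. h b \<le> h a"
    using exists_largest_values[OF V, of k h] by auto
  have finA: "finite A" using A V finite_subset by blast
  obtain \<theta> where \<theta>: "\<And>a. a \<in> A \<Longrightarrow> \<theta> \<le> h a" "\<And>b. b \<in> V - A \<Longrightarrow> h b \<le> \<theta>"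
  proof (cases "A = {}")
    case True
    \<comment> \<open>With \<open>A\<close> empty, \<theta> only has to bound \<open>h\<close> from
      above; if \<open>V\<close> is empty too, both conditions are vacuous, whatever the value of
      \<open>Max\<close> there.\<close>
    then show ?thesis using that[of "Max (h ` V)"] V by auto
  next
    case False
    then have "Min (h ` A) \<in> h ` A" using finA by (intro Min_in) auto
    then show ?thesis using that[of "Min (h ` A)"] A finA by auto
  qed
  have "0 \<le> (\<Sum>x\<in>V. (indicator A x - w x) * (h x - \<theta>))"
  proof (rule sum_nonneg)
    fix x assume "x \<in> V"
    then show "0 \<le> (indicator A x - w x) * (h x - \<theta>)"
      using w[of x] \<theta>[of x]
      by (cases "x \<in> A") (auto intro: mult_nonneg_nonneg mult_nonneg_nonpos)
  qed
  also have "\<dots> = (\<Sum>x\<in>V. indicator A x * h x) - \<theta> * (\<Sum>x\<in>V. indicator A x) -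
      (\<Sum>x\<in>V. w x * h x) + \<theta> * (\<Sum>x\<in>V. w x)"
    by (simp add: algebra_simps sum.distrib sum_subtractf sum_distrib_left)
  also have "(\<Sum>x\<in>V. indicator A x * h x) = (\<Sum>x\<in>A. h x)"
    using A V by (simp add: sum.inter_restrict[symmetric] indicator_def if_distrib[of "\<lambda>c. c * _"] Int_absorb1
        cong: if_cong)
  also have "(\<Sum>x\<in>V. indicator A x) = real k"
    using A V by (simp add: indicator_def sum.If_cases Int_absorb1)
  finally show ?thesis
    using A sum_w by auto
qed

context random_swaps
begin

text \<open>
  The starting state puts ones where \<open>P\<^sup>t f\<close> is largest. Its mean dominates that of every
  fractional configuration of the same total mass, here \<open>(1 + f) k / n\<close>.
\<close>

lemma worst_distance_from_uniform_ge:
  fixes S :: "('a \<Rightarrow> 'b) set" and \<phi> :: "'b \<Rightarrow> real"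
  assumes S: "finite S" and V: "card V \<ge> 2"
    and closed: "\<And>s y z. s \<in> S \<Longrightarrow> y \<in> V \<Longrightarrow> z \<in> V \<Longrightarrow> s \<circ> Transposition.transpose y z \<in> S"
    and sum_\<phi>: "\<And>s. s \<in> S \<Longrightarrow> (\<Sum>x\<in>V. \<phi> (s x)) = real (card V div 2)"
    and \<phi>: "\<And>y. 0 \<le> \<phi> y \<and> \<phi> y \<le> 1"
    and attain: "\<And>A. A \<subseteq> V \<Longrightarrow> card A = card V div 2 \<Longrightarrow>
      \<exists>s\<in>S. \<forall>x\<in>V. \<phi> (s x) = indicator A x"
    and f: "\<And>x. x \<in> V \<Longrightarrow> \<bar>f x\<bar> \<le> 1" "(\<Sum>x\<in>V. f x) = 0" "ip f f > 0"
    and \<rho>: "\<rho> > 0" "\<rho> * ip f f \<le> ip f (P f)"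
  shows "worst_distance_from_uniform K S t \<ge> 1 - 192 / (\<rho> ^ (2 * t) * ip f f)"
proof -
  define n where "n = card V"
  define k where "k = n div 2"
  define c where "c = real k / real n"
  \<comment> \<open>The density \<open>c\<close> lies in [1/4, 1/2] despite the rounding: the upper
    bound keeps the weights \<open>c * (1 + f)\<close> at most 1, the lower one gives
    \<open>m \<ge> a / 4\<close>.\<close>
  have "4 * k \<ge> n" "2 * k \<le> n" using V by (auto simp: k_def n_def)
  then have c: "1 / 4 \<le> c" "c \<le> 1 / 2" "c * n = k"
    using V by (auto simp: c_def n_def field_simps)
  define h where "h = (P ^^ t) f"
  define a where "a = ip f h"
  have a_ge: "a \<ge> \<rho> ^ t * ip f f"
    using ip_funpow_P_ge[of \<rho> f t] \<rho> by (simp add: a_def h_def)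
  then have a_pos: "a > 0"
    using f \<rho> by (smt (verit) mult_pos_pos zero_less_power)
  define w where "w x = c * (1 + f x)" for x
  have w: "0 \<le> w x \<and> w x \<le> 1" if "x \<in> V" for x
  proof -
    have "0 \<le> 1 + f x" "1 + f x \<le> 2" using f(1)[OF that] by auto
    then show ?thesis
      using c mult_mono[of c "1 / 2" "1 + f x" 2] by (auto simp: w_def)
  qed
  have sum_w: "(\<Sum>x\<in>V. w x) = real k"
    using c f by (simp add: w_def sum.distrib n_def flip: sum_distrib_left)
  have w_h: "(\<Sum>x\<in>V. w x * h x) = c * a"
  proof -
    have "(\<Sum>x\<in>V. w x * h x) = c * ((\<Sum>x\<in>V. h x) + a)"
      by (simp add: w_def a_def ip_def algebra_simps sum.distrib sum_distrib_left)
    then show ?thesis using f by (simp add: h_def sum_funpow_P)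
  qed
  obtain A where A: "A \<subseteq> V" "card A = k" "c * a \<le> (\<Sum>x\<in>A. h x)"
    using exists_subset_sum_ge[OF finite_V w sum_w, of h] w_h by auto
  then obtain s where s: "s \<in> S" "\<And>x. x \<in> V \<Longrightarrow> \<phi> (s x) = indicator A x"
    using attain[of A] by (auto simp: k_def n_def)
  define m where "m = ip h (\<lambda>x. \<phi> (s x))"
  have "m = (\<Sum>x\<in>V. h x * indicator A x)"
    unfolding m_def ip_def by (intro sum.cong) (auto simp: s)
  also have "\<dots> = (\<Sum>x\<in>A. h x)"
    using A finite_V by (simp add: sum.inter_restrict[symmetric] indicator_def if_distrib[of "\<lambda>c. _ * c"] Int_absorb1
        cong: if_cong)
  finally have "m \<ge> c * a" using A by simp
  moreover have "c * a \<ge> 1 / 4 * a" using c a_pos by (intro mult_right_mono) auto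
  ultimately have m: "m \<ge> \<rho> ^ t * ip f f / 4" using a_ge by simp
  have m_pos: "\<rho> ^ t * ip f f / 4 > 0" using f \<rho> by simp
  have S_ne: "S \<noteq> {}" using s by auto
  \<comment> \<open>192 is 4 * (1 + 2) * 16: the variance bounds are \<open>ip f f\<close> and
    \<open>2 * ip f f\<close>, and the lower bound on \<open>m\<close> carries the factor
    1/4.\<close>
  have "1 - 192 / (\<rho> ^ (2 * t) * ip f f) = 1 - 4 * (ip f f + 2 * ip f f) / (\<rho> ^ t * ip f f / 4)\<^sup>2"
    using f \<rho> by (simp add: field_simps power2_eq_square power_mult power_mult_distrib)
  also have "\<dots> \<le> 1 - 4 * (ip f f + 2 * ip f f) / m\<^sup>2"
    using m m_pos f by (intro diff_left_mono divide_left_mono power_mono mult_pos_pos zero_less_power) auto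
  also have "\<dots> \<le> variation_distance (chain_dist K s t) (pmf_of_set S)"
  proof (rule variation_distance_ge_moments)
    show "measure_pmf.expectation (chain_dist K s t) (\<lambda>s'. (ip f (\<lambda>x. \<phi> (s' x)) - m)\<^sup>2) \<le> ip f f"
      using chain_dist_variance_le[OF \<phi>] by (simp add: m_def h_def)
    show "measure_pmf.expectation (pmf_of_set S) (\<lambda>s. (ip f (\<lambda>x. \<phi> (s x)))\<^sup>2) \<le> 2 * ip f f"
      unfolding ip_def
      using S S_ne finite_V V closed sum_\<phi> \<phi> f(2) by (rule uniform_second_moment_le)
    show "m > 0" using m m_pos by simp
  qed (use S S_ne in auto)
  also have "\<dots> \<le> worst_distance_from_uniform K S t"
    unfolding worst_distance_from_uniform_def using S s by (intro Max_ge) auto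
  finally show ?thesis .
qed

end

subsection \<open>The grid\<close>

lemma finite_grid_vertices [simp]: "finite (grid_vertices l)"
  by (simp add: grid_vertices_def)

lemma card_grid_vertices [simp]: "card (grid_vertices l) = l\<^sup>2"
  by (simp add: grid_vertices_def power2_eq_square)

definition adjacent :: "vertex \<Rightarrow> vertex \<Rightarrow> bool" where
  "adjacent v w \<longleftrightarrow>
    fst v = fst w \<and> (snd w = Suc (snd v) \<or> snd v = Suc (snd w)) \<or>
    snd v = snd w \<and> (fst w = Suc (fst v) \<or> fst v = Suc (fst w))"

lemma adjacent_commute: "adjacent v w \<longleftrightarrow> adjacent w v"
  by (auto simp: adjacent_def)

lemma adjacent_irrefl [simp]: "\<not> adjacent v v"
  by (auto simp: adjacent_def)

text \<open>Two integer squares with sum 1 are 0 and 1 in some order.\<close>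

lemma dist_eq_1_iff_adjacent:
  "dist (real i, real j) (real i', real j') = 1 \<longleftrightarrow> adjacent (i, j) (i', j')"
proof -
  define a b where "a = int i - int i'" and "b = int j - int j'"
  have "dist (real i, real j) (real i', real j') = 1 \<longleftrightarrow> real_of_int (a\<^sup>2 + b\<^sup>2) = 1"
    by (simp add: dist_Pair_Pair dist_real_def a_def b_def)
  also have "\<dots> \<longleftrightarrow> a\<^sup>2 + b\<^sup>2 = 1"
    by linarith
  also have "\<dots> \<longleftrightarrow> (a = 0 \<and> \<bar>b\<bar> = 1) \<or> (b = 0 \<and> \<bar>a\<bar> = 1)"
  proof
    assume eq: "a\<^sup>2 + b\<^sup>2 = 1"
    then have "a\<^sup>2 \<le> 1" "b\<^sup>2 \<le> 1"
      using zero_le_power2[of a] zero_le_power2[of b] by linarith+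
    then have "\<bar>a\<bar> \<le> 1" "\<bar>b\<bar> \<le> 1"
      by (simp_all add: abs_square_le_1)
    then have "a \<in> {-1, 0, 1}" "b \<in> {-1, 0, 1}" by auto
    then show "(a = 0 \<and> \<bar>b\<bar> = 1) \<or> (b = 0 \<and> \<bar>a\<bar> = 1)"
      using eq by auto
  next
    assume "(a = 0 \<and> \<bar>b\<bar> = 1) \<or> (b = 0 \<and> \<bar>a\<bar> = 1)"
    then show "a\<^sup>2 + b\<^sup>2 = 1"
      by (metis add.commute add_0 one_power2 power2_abs zero_power2)
  qed
  also have "\<dots> \<longleftrightarrow> adjacent (i, j) (i', j')"
    by (auto simp: a_def b_def adjacent_def)
  finally show ?thesis .
qed

definition neighbours :: "nat \<Rightarrow> vertex \<Rightarrow> vertex set" where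
  "neighbours l v = {w \<in> grid_vertices l. adjacent v w}"

lemma finite_neighbours [simp]: "finite (neighbours l v)"
  by (simp add: neighbours_def)

text \<open>Since \<open>w\<close> determines the edge injectively, a uniform incident edge is the
  same as a uniform neighbour.\<close>

lemma incident_edges_eq:
  assumes "v \<in> grid_vertices l"
  shows "incident_edges l v = (\<lambda>w. {v, w}) ` neighbours l v"
proof (intro set_eqI iffI)
  have "grid_edges l = {{u, w} | u w. u \<in> grid_vertices l \<and> w \<in> grid_vertices l \<and> adjacent u w}"
    unfolding grid_edges_def dist_eq_1_iff_adjacent by force
  then have edges: "e \<in> grid_edges l \<longleftrightarrow>
      (\<exists>u\<in>grid_vertices l. \<exists>w\<in>grid_vertices l. adjacent u w \<and> e = {u, w})" for e
    by blast
  fix e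
  {
    assume "e \<in> incident_edges l v"
    then obtain u w where "u \<in> grid_vertices l" "w \<in> grid_vertices l" "adjacent u w" "e = {u, w}" "v \<in> e"
      unfolding incident_edges_def edges by blast
    then show "e \<in> (\<lambda>w. {v, w}) ` neighbours l v"
      by (auto simp: neighbours_def adjacent_commute insert_commute)
  next
    assume "e \<in> (\<lambda>w. {v, w}) ` neighbours l v"
    then show "e \<in> incident_edges l v"
      using assms unfolding incident_edges_def edges by (auto simp: neighbours_def)
  }
qed

lemma inj_on_edge: "inj_on (\<lambda>w. {v, w}) A"
  by (auto simp: inj_on_def doubleton_eq_iff)

lemma neighbours_subset:
  "neighbours l (i, j) \<subseteq> {(Suc i, j), (i - 1, j), (i, Suc j), (i, j - 1)}"
  by (auto simp: neighbours_def adjacent_def)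

lemma card_neighbours_interior:
  assumes "i \<in> {2..<l}" "j \<in> {2..<l}"
  shows "card (neighbours l (i, j)) = 4"
proof -
  have "neighbours l (i, j) = {(Suc i, j), (i - 1, j), (i, Suc j), (i, j - 1)}"
    using assms neighbours_subset[of l i j] by (auto simp: neighbours_def adjacent_def grid_vertices_def)
  then show ?thesis using assms by auto
qed

lemma card_neighbours_ge:
  assumes "l \<ge> 2" "(i, j) \<in> grid_vertices l"
  shows "card (neighbours l (i, j)) \<ge> 2"
proof -
  define i' where "i' = (if i < l then Suc i else i - 1)"
  define j' where "j' = (if j < l then Suc j else j - 1)"
  have "{(i', j), (i, j')} \<subseteq> neighbours l (i, j)"
    using assms by (auto simp: i'_def j'_def neighbours_def adjacent_def grid_vertices_def)
  moreover have "(i', j) \<noteq> (i, j')"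
    using assms by (auto simp: i'_def grid_vertices_def)
  then have "card {(i', j), (i, j')} = 2" by simp
  ultimately show ?thesis by (metis card_mono finite_neighbours)
qed

section \<open>The law of the exchanged edge\<close>

definition edge_pmf :: "nat \<Rightarrow> vertex set pmf" where
  "edge_pmf l = bind_pmf (pmf_of_set (grid_vertices l)) (\<lambda>v. pmf_of_set (incident_edges l v))"

lemma vertex_driven_step_eq:
  "vertex_driven_step l s = map_pmf (\<lambda>e x. s (swap_along e x)) (edge_pmf l)"
proof -
  have "exchange e s = (\<lambda>x. s (swap_along e x))" for e
    by (auto simp: exchange_def swap_along_def)
  then show ?thesis
    by (simp add: vertex_driven_step_def edge_pmf_def map_pmf_def bind_assoc_pmf)
qed

context
  fixes l :: nat
  assumes l: "l \<ge> 2"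
begin

lemma grid_vertices_nonempty: "grid_vertices l \<noteq> {}"
  using l by (auto simp: grid_vertices_def)

lemma neighbours_nonempty: "v \<in> grid_vertices l \<Longrightarrow> neighbours l v \<noteq> {}"
  using card_neighbours_ge[OF l, of "fst v" "snd v"] by auto

lemma finite_incident_edges: "v \<in> grid_vertices l \<Longrightarrow> finite (incident_edges l v)"
  by (simp add: incident_edges_eq)

lemma incident_edges_nonempty: "v \<in> grid_vertices l \<Longrightarrow> incident_edges l v \<noteq> {}"
  by (simp add: incident_edges_eq neighbours_nonempty)

lemma set_edge_pmf: "set_pmf (edge_pmf l) = (\<Union>v\<in>grid_vertices l. incident_edges l v)"
  by (simp add: edge_pmf_def grid_vertices_nonempty incident_edges_nonempty finite_incident_edges)

lemma expectation_edge_pmf: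
  "measure_pmf.expectation (edge_pmf l) F =
    (\<Sum>v\<in>grid_vertices l. (\<Sum>w\<in>neighbours l v. F {v, w}) / card (neighbours l v)) / (real l)\<^sup>2"
proof -
  have inner: "measure_pmf.expectation (pmf_of_set (incident_edges l v)) F =
      (\<Sum>w\<in>neighbours l v. F {v, w}) / card (neighbours l v)" if "v \<in> grid_vertices l" for v
    using that incident_edges_nonempty[OF that] finite_incident_edges[OF that]
    by (simp add: integral_pmf_of_set)
      (simp add: incident_edges_eq sum.reindex[OF inj_on_edge] card_image[OF inj_on_edge])
  have "measure_pmf.expectation (edge_pmf l) F =
      measure_pmf.expectation (pmf_of_set (grid_vertices l))
        (\<lambda>v. measure_pmf.expectation (pmf_of_set (incident_edges l v)) F)"
    unfolding edge_pmf_def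
    by (rule expectation_bind_pmf_finite)
      (simp_all add: grid_vertices_nonempty incident_edges_nonempty finite_incident_edges)
  then show ?thesis
    by (simp add: integral_pmf_of_set grid_vertices_nonempty inner)
qed

text \<open>The chosen edge can contain \<open>x\<close> only if the chosen vertex is
  \<open>x\<close> or one of its at most four neighbours.\<close>

lemma prob_edge_pmf_le: "measure_pmf.prob (edge_pmf l) {e. x \<in> e} \<le> 5 / (real l)\<^sup>2"
proof -
  define B where "B = insert x (neighbours l x)"
  have "card B \<le> Suc (card (neighbours l x))"
    unfolding B_def by (simp add: card_insert_if)
  \<comment> \<open>The four candidates may coincide under truncated subtraction, so their number is
    bounded by the length of a list.\<close>
  also have "card (neighbours l x) \<le> 4"
    using card_mono[OF _ neighbours_subset[of l "fst x" "snd x"]]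
      card_length[of "[(Suc (fst x), snd x), (fst x - 1, snd x), (fst x, Suc (snd x)), (fst x, snd x - 1)]"]
    by simp
  finally have card_B: "card B \<le> 5" by simp
  have "measure_pmf.prob (edge_pmf l) {e. x \<in> e} =
      measure_pmf.expectation (edge_pmf l) (indicator {e. x \<in> e})"
    by simp
  also have "\<dots> \<le> (\<Sum>v\<in>grid_vertices l. indicator B v) / (real l)\<^sup>2"
    unfolding expectation_edge_pmf
  proof (intro divide_right_mono sum_mono)
    fix v assume v: "v \<in> grid_vertices l"
    have "card (neighbours l v) > 0" using neighbours_nonempty[OF v] by (simp add: card_gt_0_iff)
    moreover have "(\<Sum>w\<in>neighbours l v. indicator {e. x \<in> e} {v, w}) \<le> (\<Sum>w\<in>neighbours l v. indicator B v :: real)"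
      using v by (intro sum_mono) (auto simp: B_def neighbours_def adjacent_commute indicator_def)
    ultimately show "(\<Sum>w\<in>neighbours l v. indicator {e. x \<in> e} {v, w}) / card (neighbours l v) \<le> (indicator B v :: real)"
      by (simp add: divide_le_eq mult.commute)
  qed simp
  also have "(\<Sum>v\<in>grid_vertices l. indicator B v :: real) = card (grid_vertices l \<inter> B)"
    by (simp add: indicator_def sum.If_cases)
  also have "\<dots> \<le> card B"
    by (simp add: B_def card_mono)
  also have "real (card B) / (real l)\<^sup>2 \<le> 5 / (real l)\<^sup>2"
    using card_B by (intro divide_right_mono) auto
  finally show ?thesis by (simp add: divide_right_mono)
qed

end

lemma random_swaps_grid:
  assumes l: "l \<ge> 4"
  shows "random_swaps (grid_vertices l) (edge_pmf l)"
proof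
  have l2: "l \<ge> 2" using l by simp
  show "finite (set_pmf (edge_pmf l))"
    using finite_incident_edges[OF l2] by (simp add: set_edge_pmf[OF l2])
  show "\<exists>x\<in>grid_vertices l. \<exists>y\<in>grid_vertices l. x \<noteq> y \<and> e = {x, y}"
    if e: "e \<in> set_pmf (edge_pmf l)" for e
  proof -
    obtain v w where "v \<in> grid_vertices l" "w \<in> neighbours l v" "e = {v, w}"
      using e by (auto simp: set_edge_pmf[OF l2] incident_edges_eq)
    then show ?thesis by (intro bexI[of _ v] bexI[of _ w]) (auto simp: neighbours_def)
  qed
  \<comment> \<open>For \<open>l \<ge> 4\<close> the probability is at most 5/16, which ensures
    laziness.\<close>
  have "(4::real)\<^sup>2 \<le> (real l)\<^sup>2" using l by (intro power_mono) auto
  then have "5 / (real l)\<^sup>2 \<le> 1 / 2" using l by (simp add: divide_le_eq)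
  then show "measure_pmf.prob (edge_pmf l) {e. x \<in> e} \<le> 1 / 2" for x
    using prob_edge_pmf_le[OF l2, of x] by linarith
qed simp

section \<open>The cosine mode and its Dirichlet form\<close>

definition cosine_mode :: "nat \<Rightarrow> vertex \<Rightarrow> real" where
  "cosine_mode l v = cos (pi / l * (real (fst v) - 1 / 2))"

text \<open>The factor \<open>2 * sin (\<beta> / 2)\<close> turns each cosine into a difference of
  sines half a step away on either side, and the sum telescopes.\<close>

lemma sum_cos_arith:
  "2 * sin (\<beta> / 2) * (\<Sum>i=1..l. cos (\<beta> * real i + \<alpha>)) =
    sin (\<beta> * real l + \<alpha> + \<beta> / 2) - sin (\<alpha> + \<beta> / 2)"
proof (induction l)
  case (Suc l)
  have "2 * sin (\<beta> / 2) * cos (\<beta> * real (Suc l) + \<alpha>) =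
      sin (\<beta> * real (Suc l) + \<alpha> + \<beta> / 2) - sin (\<beta> * real (Suc l) + \<alpha> - \<beta> / 2)"
    by (simp add: sin_add sin_diff)
  also have "\<beta> * real (Suc l) + \<alpha> - \<beta> / 2 = \<beta> * real l + \<alpha> + \<beta> / 2"
    by (simp add: algebra_simps)
  finally show ?case using Suc by (simp add: algebra_simps)
qed simp

lemma sum_cos_mode:
  assumes "l \<ge> 2"
  shows "(\<Sum>i=1..l. cos (pi / l * (real i - 1 / 2))) = 0"
proof -
  have "sin (pi / l / 2) > 0"
    using assms by (intro sin_gt_zero) (auto simp: field_simps)
  moreover have "pi / l * real i + - (pi / l / 2) = pi / l * (real i - 1 / 2)" for i
    by (simp add: algebra_simps)
  ultimately show ?thesis
    using sum_cos_arith[where \<beta> = "pi / l" and l = l and \<alpha> = "- (pi / l / 2)"] assms by simp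
qed

text \<open>The telescoped sines differ by a full period.\<close>

lemma sum_cos_double_mode:
  assumes "l \<ge> 2"
  shows "(\<Sum>i=1..l. cos (2 * (pi / l) * real i + \<alpha>)) = 0"
proof -
  have "sin (pi / l) > 0"
    using assms by (intro sin_gt_zero) (auto simp: field_simps)
  moreover have "sin (2 * (pi / l) * real l + \<alpha> + pi / l) = sin (\<alpha> + pi / l + 2 * pi)"
    using assms by (simp add: algebra_simps)
  ultimately show ?thesis
    using sum_cos_arith[where \<beta> = "2 * (pi / l)" and l = l and \<alpha> = \<alpha>] by (simp only: sin_periodic) simp
qed

text \<open>The phase is free because several are used: -1/2 for the norm of the mode, 0 and -1 for
  its increments on the two sides of a vertex.\<close>

lemma sum_sin_squared_mode:
  assumes "l \<ge> 2"
  shows "(\<Sum>i=1..l. (sin (pi / l * (real i + \<alpha>)))\<^sup>2) = real l / 2"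
proof -
  have "(sin (pi / l * (real i + \<alpha>)))\<^sup>2 = 1 / 2 - cos (2 * (pi / l) * real i + 2 * (pi / l) * \<alpha>) / 2" for i
    using cos_double_sin[of "pi / l * (real i + \<alpha>)"] by (simp add: algebra_simps add_divide_distrib)
  then show ?thesis
    using sum_cos_double_mode[OF assms] by (simp add: sum_subtractf flip: sum_divide_distrib)
qed

lemma sum_cos_squared_mode:
  assumes "l \<ge> 2"
  shows "(\<Sum>i=1..l. (cos (pi / l * (real i + \<alpha>)))\<^sup>2) = real l / 2"
  using sum_sin_squared_mode[OF assms, of \<alpha>] by (simp add: cos_squared_eq sum_subtractf)

lemma cos_mode_increment_le:
  fixes \<theta> :: real
  shows "(cos (\<theta> * (x - 1 / 2)) - cos (\<theta> * (x + 1 / 2)))\<^sup>2 \<le> \<theta>\<^sup>2 * (sin (\<theta> * x))\<^sup>2"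
proof -
  have "cos (\<theta> * (x - 1 / 2)) - cos (\<theta> * (x + 1 / 2)) = 2 * sin (\<theta> / 2) * sin (\<theta> * x)"
    by (simp add: algebra_simps cos_add cos_diff)
  moreover have "(2 * sin (\<theta> / 2))\<^sup>2 \<le> \<theta>\<^sup>2"
  proof -
    have "\<bar>sin (\<theta> / 2)\<bar> \<le> \<bar>\<theta>\<bar> / 2" using abs_sin_x_le_abs_x[of "\<theta> / 2"] by simp
    then have "\<bar>2 * sin (\<theta> / 2)\<bar> \<le> \<bar>\<theta>\<bar>" by (simp add: abs_mult)
    then show ?thesis by (simp only: abs_le_square_iff)
  qed
  ultimately show ?thesis
    by (simp add: power_mult_distrib mult_right_mono)
qed

lemma sum_grid_columns: "(\<Sum>v\<in>grid_vertices l. g (fst v)) = real l * (\<Sum>i=1..l. g i :: real)"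
proof -
  have "(\<Sum>v\<in>grid_vertices l. g (fst v)) = (\<Sum>(i, j)\<in>{1..l} \<times> {1..l}. g i)"
    by (simp add: grid_vertices_def case_prod_beta')
  also have "\<dots> = (\<Sum>i=1..l. \<Sum>j=1..l. g i)"
    by (rule sum.cartesian_product[symmetric])
  finally show ?thesis by (simp add: sum_distrib_left)
qed

lemma sum_cosine_mode: "l \<ge> 2 \<Longrightarrow> (\<Sum>v\<in>grid_vertices l. cosine_mode l v) = 0"
  unfolding cosine_mode_def sum_grid_columns[of "\<lambda>i. cos (pi / l * (real i - 1 / 2))"]
  by (simp only: sum_cos_mode mult_zero_right)

lemma sum_cosine_mode_squared:
  assumes "l \<ge> 2"
  shows "(\<Sum>v\<in>grid_vertices l. cosine_mode l v * cosine_mode l v) = (real l)\<^sup>2 / 2"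
  using sum_cos_squared_mode[OF assms, of "- 1 / 2"]
    sum_grid_columns[of "\<lambda>i. (cos (pi / l * (real i - 1 / 2)))\<^sup>2" l]
  by (simp add: cosine_mode_def power2_eq_square)

text \<open>
  Edges between interior vertices have weight \<open>1/4 + 1/4\<close>, which gives the main term
  \<open>\<pi>\<^sup>2 / 4\<close>. The \<open>O(l)\<close> boundary vertices only contribute to the lower-order term.
\<close>

lemma cosine_mode_dirichlet_le:
  assumes l: "l \<ge> 2"
  shows "measure_pmf.expectation (edge_pmf l) (\<lambda>e. edge_form e (cosine_mode l) (cosine_mode l))
    \<le> (pi\<^sup>2 / 4 + 2 * pi\<^sup>2 / l) / (real l)\<^sup>2"
proof -
  define \<theta> where "\<theta> = pi / l"
  define f where "f = cosine_mode l"
  \<comment> \<open>\<open>d i\<close> bounds the squared increments from column \<open>i\<close> to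
    \<open>i + 1\<close> and \<open>i - 1\<close>; the sines sit at the midpoints. The summands
    \<open>0\<close> and \<open>- 1\<close> match the phase in
    \<open>sum_sin_squared_mode\<close>.\<close>
  define d where "d i = \<theta>\<^sup>2 * (sin (\<theta> * (real i + 0)))\<^sup>2 + \<theta>\<^sup>2 * (sin (\<theta> * (real i + - 1)))\<^sup>2" for i
  define bd where "bd = grid_vertices l - {2..<l} \<times> {2..<l}"
  have d: "0 \<le> d i" "d i \<le> 2 * \<theta>\<^sup>2" for i
  proof -
    have "\<theta>\<^sup>2 * (sin x)\<^sup>2 \<le> \<theta>\<^sup>2 * 1" for x
      by (intro mult_left_mono) (auto simp: abs_square_le_1)
    from this[of "\<theta> * (real i + 0)"] this[of "\<theta> * (real i + - 1)"] show "d i \<le> 2 * \<theta>\<^sup>2"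
      by (simp add: d_def)
  qed (simp add: d_def)
  have vertex: "(\<Sum>w\<in>neighbours l v. edge_form {v, w} f f) / card (neighbours l v) \<le>
      d (fst v) / 4 + indicator bd v * (\<theta>\<^sup>2 / 2)" if v: "v \<in> grid_vertices l" for v
  proof -
    obtain i j where ij: "v = (i, j)" by force
    have pos: "i \<ge> 1" "j \<ge> 1" using v ij by (auto simp: grid_vertices_def)
    have "(\<Sum>w\<in>neighbours l v. edge_form {v, w} f f) = (\<Sum>w\<in>neighbours l v. (f v - f w)\<^sup>2)"
      by (intro sum.cong refl, subst edge_form_pair) (auto simp: neighbours_def power2_eq_square)
    \<comment> \<open>Virtual neighbours outside the grid may be added: the shift by 1/2 makes the
      mode at 0 and \<open>l + 1\<close> repeat its boundary values, and it is constant in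
      \<open>j\<close>.\<close>
    also have "\<dots> \<le> (\<Sum>w\<in>{(Suc i, j), (i - 1, j), (i, Suc j), (i, j - 1)}. (f v - f w)\<^sup>2)"
      using neighbours_subset[of l i j] by (intro sum_mono2) (auto simp: ij)
    also have "\<dots> = (f (i, j) - f (Suc i, j))\<^sup>2 + (f (i, j) - f (i - 1, j))\<^sup>2"
      using pos by (simp add: ij) (simp add: f_def cosine_mode_def)
    also have "\<dots> \<le> d i"
      using cos_mode_increment_le[of \<theta> i] cos_mode_increment_le[of \<theta> "real i - 1"] pos
      by (simp add: d_def f_def cosine_mode_def \<theta>_def of_nat_diff power2_commute algebra_simps)
    finally have sum_le: "(\<Sum>w\<in>neighbours l v. edge_form {v, w} f f) \<le> d i" .
    show ?thesis
    proof (cases "v \<in> bd")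
      case True
      \<comment> \<open>A boundary vertex has degree at least 2, and \<open>d i / 2\<close> exceeds
        \<open>d i / 4\<close> by at most \<open>\<theta>^2 / 2\<close>.\<close>
      have "(\<Sum>w\<in>neighbours l v. edge_form {v, w} f f) / card (neighbours l v) \<le> d i / 2"
        using sum_le d[of i] card_neighbours_ge[OF l, of i j] v ij by (intro frac_le) auto
      then show ?thesis using True d[of i] by (simp add: ij)
    next
      case False
      then have "card (neighbours l v) = 4"
        using v by (auto simp: bd_def ij card_neighbours_interior)
      then show ?thesis using sum_le False by (simp add: ij)
    qed
  qed
  have sum_d: "(\<Sum>v\<in>grid_vertices l. d (fst v) / 4) = pi\<^sup>2 / 4"
  proof -
    have "(\<Sum>i=1..l. d i) = \<theta>\<^sup>2 * real l"
      using sum_sin_squared_mode[OF l, of 0] sum_sin_squared_mode[OF l, of "- 1"]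
      by (simp only: d_def \<theta>_def sum.distrib flip: sum_distrib_left)
    then have "(\<Sum>v\<in>grid_vertices l. d (fst v) / 4) = real l * (\<theta>\<^sup>2 * real l) / 4"
      using sum_grid_columns[of d l] by (simp flip: sum_divide_distrib)
    then show ?thesis using l by (simp add: \<theta>_def power2_eq_square)
  qed
  have card_bd: "real (card (grid_vertices l \<inter> bd)) \<le> 4 * real l"
  proof -
    have "grid_vertices l \<inter> bd \<subseteq> {1, l} \<times> {1..l} \<union> {1..l} \<times> {1, l}"
      by (auto simp: bd_def grid_vertices_def)
    then have "card (grid_vertices l \<inter> bd) \<le> card ({1, l} \<times> {1..l} \<union> {1..l} \<times> {1, l})"
      by (intro card_mono) auto
    also have "\<dots> \<le> card ({1, l} \<times> {1..l}) + card ({1..l} \<times> {1, l})"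
      by (rule card_Un_le)
    also have "\<dots> = 4 * l" using l by simp
    finally show ?thesis by simp
  qed
  have "(\<Sum>v\<in>grid_vertices l. (\<Sum>w\<in>neighbours l v. edge_form {v, w} f f) / card (neighbours l v)) \<le>
      (\<Sum>v\<in>grid_vertices l. d (fst v) / 4 + indicator bd v * (\<theta>\<^sup>2 / 2))"
    by (intro sum_mono vertex)
  also have "\<dots> = pi\<^sup>2 / 4 + real (card (grid_vertices l \<inter> bd)) * (\<theta>\<^sup>2 / 2)"
    unfolding sum.distrib sum_d sum_distrib_right[symmetric]
    by (simp add: indicator_def sum.If_cases)
  also have "\<dots> \<le> pi\<^sup>2 / 4 + 4 * real l * (\<theta>\<^sup>2 / 2)"
    using card_bd by (intro add_left_mono mult_right_mono) auto
  also have "\<dots> = pi\<^sup>2 / 4 + 2 * pi\<^sup>2 / l"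
    using l by (simp add: \<theta>_def field_simps power2_eq_square)
  finally show ?thesis
    unfolding expectation_edge_pmf[OF l] f_def by (rule divide_right_mono) simp
qed

subsection \<open>Arrangements\<close>

lemma bij_betw_transpose: "y \<in> V \<Longrightarrow> z \<in> V \<Longrightarrow> bij_betw (Transposition.transpose y z) V V"
  by (rule bij_betw_byWitness[of _ "Transposition.transpose y z"]) (auto simp: Transposition.transpose_def)

lemma comp_transpose_PiE:
  "s \<in> V \<rightarrow>\<^sub>E B \<Longrightarrow> y \<in> V \<Longrightarrow> z \<in> V \<Longrightarrow> s \<circ> Transposition.transpose y z \<in> V \<rightarrow>\<^sub>E B"
  by (auto simp: PiE_iff extensional_def Transposition.transpose_def)

lemma distinct_arrangements_transpose:
  assumes "s \<in> distinct_arrangements l" "y \<in> grid_vertices l" "z \<in> grid_vertices l"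
  shows "s \<circ> Transposition.transpose y z \<in> distinct_arrangements l"
  using assms comp_transpose_PiE[of s "grid_vertices l" "{1..l^2}" y z]
    bij_betw_trans[OF bij_betw_transpose[of y "grid_vertices l" z], of s]
  by (simp add: distinct_arrangements_def)

lemma binary_arrangements_transpose:
  assumes "s \<in> binary_arrangements l" "y \<in> grid_vertices l" "z \<in> grid_vertices l"
  shows "s \<circ> Transposition.transpose y z \<in> binary_arrangements l"
proof -
  let ?\<tau> = "Transposition.transpose y z"
  have "?\<tau> v \<in> grid_vertices l" if "v \<in> grid_vertices l" for v
    using bij_betwE[OF bij_betw_transpose[OF assms(2,3)]] that by blast
  then have "bij_betw ?\<tau> {v \<in> grid_vertices l. (s \<circ> ?\<tau>) v = 1} {v \<in> grid_vertices l. s v = 1}"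
    by (intro bij_betw_byWitness[of _ ?\<tau>]) auto
  then have "card {v \<in> grid_vertices l. (s \<circ> ?\<tau>) v = 1} = card {v \<in> grid_vertices l. s v = 1}"
    by (rule bij_betw_same_card)
  then show ?thesis
    using assms comp_transpose_PiE[of s "grid_vertices l" "{0, 1}" y z]
    by (simp add: binary_arrangements_def)
qed

lemma finite_distinct_arrangements: "finite (distinct_arrangements l)"
  unfolding distinct_arrangements_def
  by (rule finite_subset[OF _ finite_PiE[of "grid_vertices l" "\<lambda>_. {1..l^2}"]]) auto

lemma finite_binary_arrangements: "finite (binary_arrangements l)"
  unfolding binary_arrangements_def
  by (rule finite_subset[OF _ finite_PiE[of "grid_vertices l" "\<lambda>_. {0, 1}"]]) auto

text \<open>Distinct cards are observed only through the colouring that marks the cards up to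
  \<open>k\<close> as ones. Bijectivity fixes the number of ones.\<close>

lemma distinct_arrangements_sum:
  assumes "s \<in> distinct_arrangements l" "k \<le> l\<^sup>2"
  shows "(\<Sum>x\<in>grid_vertices l. if s x \<le> k then 1 else 0 :: real) = real k"
proof -
  have "(\<Sum>x\<in>grid_vertices l. if s x \<le> k then 1 else 0 :: real) = (\<Sum>c=1..l\<^sup>2. if c \<le> k then 1 else 0)"
    using assms by (intro sum.reindex_bij_betw) (simp add: distinct_arrangements_def)
  also have "\<dots> = real (card ({1..l\<^sup>2} \<inter> {c. c \<le> k}))"
    by (simp add: sum.If_cases)
  also have "{1..l\<^sup>2} \<inter> {c. c \<le> k} = {1..k}" using assms by auto
  finally show ?thesis by simp
qed

text \<open>The cards up to \<open>k\<close> are dealt to \<open>A\<close> and the others to its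
  complement, each in any order.\<close>

lemma distinct_arrangements_attain:
  assumes A: "A \<subseteq> grid_vertices l" "card A = k"
  shows "\<exists>s\<in>distinct_arrangements l. \<forall>x\<in>grid_vertices l.
    (if s x \<le> k then 1 else 0 :: real) = indicator A x"
proof -
  let ?V = "grid_vertices l"
  have finA: "finite A" using A(1) by (rule finite_subset) simp
  have k: "k \<le> l\<^sup>2" using card_mono[OF _ A(1)] A(2) by simp
  obtain g where g: "bij_betw g A {1..k}"
    using finite_same_card_bij[OF finA, of "{1..k}"] A by auto
  obtain h where h: "bij_betw h (?V - A) {Suc k..l\<^sup>2}"
    using finite_same_card_bij[of "?V - A" "{Suc k..l\<^sup>2}"] A k by (auto simp: card_Diff_subset finA)
  define s where "s x = (if x \<in> A then g x else if x \<in> ?V then h x else undefined)" for x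
  have sA: "bij_betw s A {1..k}"
    using g by (rule bij_betw_cong[THEN iffD1, rotated]) (simp add: s_def)
  have sB: "bij_betw s (?V - A) {Suc k..l\<^sup>2}"
    using h by (rule bij_betw_cong[THEN iffD1, rotated]) (simp add: s_def)
  have "bij_betw s (A \<union> (?V - A)) ({1..k} \<union> {Suc k..l\<^sup>2})"
    by (rule bij_betw_combine[OF sA sB]) auto
  moreover have "A \<union> (?V - A) = ?V" "{1..k} \<union> {Suc k..l\<^sup>2} = {1..l\<^sup>2}"
    using A k by auto
  ultimately have bij: "bij_betw s ?V {1..l\<^sup>2}" by simp
  have "s \<in> ?V \<rightarrow>\<^sub>E {1..l\<^sup>2}"
  proof (rule PiE_I)
    show "s x \<in> {1..l\<^sup>2}" if "x \<in> ?V" for x using bij_betwE[OF bij] that by blast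
    show "s x = undefined" if "x \<notin> ?V" for x using A that by (auto simp: s_def)
  qed
  then have "s \<in> distinct_arrangements l"
    using bij by (simp add: distinct_arrangements_def)
  moreover have "(if s x \<le> k then 1 else 0 :: real) = indicator A x" if "x \<in> ?V" for x
    using bij_betwE[OF sA] bij_betwE[OF sB] that by (cases "x \<in> A") (force simp: indicator_def)+
  ultimately show ?thesis by blast
qed

lemma binary_arrangements_sum:
  assumes "s \<in> binary_arrangements l"
  shows "(\<Sum>x\<in>grid_vertices l. if s x = 1 then 1 else 0 :: real) = real (l\<^sup>2 div 2)"
  using assms by (simp add: binary_arrangements_def sum.If_cases Int_def)

lemma binary_arrangements_attain:
  assumes A: "A \<subseteq> grid_vertices l" "card A = l\<^sup>2 div 2"
  shows "\<exists>s\<in>binary_arrangements l. \<forall>x\<in>grid_vertices l.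
    (if s x = 1 then 1 else 0 :: real) = indicator A x"
proof -
  define s :: arrangement where
    "s = (\<lambda>x\<in>grid_vertices l. if x \<in> A then 1 else 0)"
  have "{v \<in> grid_vertices l. s v = 1} = A"
    using A by (auto simp: s_def split: if_splits)
  then have "s \<in> binary_arrangements l"
    using A by (auto simp: binary_arrangements_def s_def)
  then show ?thesis
    by (intro bexI[of _ s]) (auto simp: s_def)
qed

section \<open>The lower bound on the grid and its asymptotics\<close>

lemma grid_worst_distance_ge:
  fixes \<phi> :: "nat \<Rightarrow> real"
  assumes l: "l \<ge> 4" and S: "finite S"
    and closed: "\<And>s y z. s \<in> S \<Longrightarrow> y \<in> grid_vertices l \<Longrightarrow> z \<in> grid_vertices l \<Longrightarrow>
      s \<circ> Transposition.transpose y z \<in> S"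
    and sum_\<phi>: "\<And>s. s \<in> S \<Longrightarrow> (\<Sum>x\<in>grid_vertices l. \<phi> (s x)) = real (l\<^sup>2 div 2)"
    and \<phi>: "\<And>y. 0 \<le> \<phi> y \<and> \<phi> y \<le> 1"
    and attain: "\<And>A. A \<subseteq> grid_vertices l \<Longrightarrow> card A = l\<^sup>2 div 2 \<Longrightarrow>
      \<exists>s\<in>S. \<forall>x\<in>grid_vertices l. \<phi> (s x) = indicator A x"
    and \<rho>: "\<rho> = 1 - pi\<^sup>2 / (2 * real l ^ 4) * (1 + 8 / l)" "\<rho> > 0"
  shows "worst_distance_from_uniform (vertex_driven_step l) S t \<ge> 1 - 384 / (\<rho> ^ (2 * t) * (real l)\<^sup>2)"
proof -
  interpret random_swaps "grid_vertices l" "edge_pmf l"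
    using l by (rule random_swaps_grid)
  have l2: "l \<ge> 2" using l by simp
  have step: "vertex_driven_step l = K"
    by (rule ext) (simp add: K_def vertex_driven_step_eq)
  let ?f = "cosine_mode l"
  have ff: "ip ?f ?f = (real l)\<^sup>2 / 2"
    using sum_cosine_mode_squared[OF l2] by (simp add: ip_def)
  have "ip ?f (P ?f) \<ge> (real l)\<^sup>2 / 2 - (pi\<^sup>2 / 4 + 2 * pi\<^sup>2 / l) / (real l)\<^sup>2"
    using cosine_mode_dirichlet_le[OF l2] by (simp add: ip_P ff)
  \<comment> \<open>The Dirichlet bound divided by the squared norm \<open>l^2 / 2\<close> is
    exactly \<open>1 - \<rho>\<close>. The same norm turns 192 into 384 below.\<close>
  also have "(real l)\<^sup>2 / 2 - (pi\<^sup>2 / 4 + 2 * pi\<^sup>2 / l) / (real l)\<^sup>2 = \<rho> * ip ?f ?f"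
    using l by (simp add: ff \<rho>(1) field_simps eval_nat_numeral)
  finally have rayleigh: "\<rho> * ip ?f ?f \<le> ip ?f (P ?f)" .
  have "2\<^sup>2 \<le> l\<^sup>2" using l by (intro power_mono) auto
  then have "1 - 192 / (\<rho> ^ (2 * t) * ip ?f ?f) \<le> worst_distance_from_uniform K S t"
    using sum_cosine_mode[OF l2] l
    by (intro worst_distance_from_uniform_ge[where \<phi> = \<phi>] S closed sum_\<phi> \<phi> attain rayleigh \<rho>(2))
      (auto simp: sum_\<phi> attain ff cosine_mode_def)
  then show ?thesis by (simp add: step ff)
qed

text \<open>With \<open>\<eta> = \<delta> \<pi>\<^sup>2 / 2\<close> the exponent \<open>2 t ln \<rho>\<close> is at least \<open>- (2 - \<eta>) ln l\<close> for large \<open>l\<close>.\<close>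

lemma eventually_power_ge:
  fixes \<delta> C :: real
  assumes \<delta>: "\<delta> > 0"
  defines "\<rho> \<equiv> \<lambda>l::nat. 1 - pi\<^sup>2 / (2 * real l ^ 4) * (1 + 8 / real l)"
  shows "\<forall>\<^sub>F l in sequentially. 0 < \<rho> l \<and>
    (\<forall>t::nat. real t \<le> (2 / pi\<^sup>2 - \<delta>) * real l ^ 4 * ln (real l) \<longrightarrow>
      C \<le> \<rho> l ^ (2 * t) * (real l)\<^sup>2)"
proof -
  define \<eta> where "\<eta> = \<delta> * pi\<^sup>2 / 2"
  have \<eta>: "\<eta> > 0" using \<delta> by (simp add: \<eta>_def)
  define \<gamma> where "\<gamma> l = pi\<^sup>2 / (2 * real l ^ 4) * (1 + 8 / real l)" for l :: nat
  \<comment> \<open>The factor \<open>1 + 8 / l\<close> comes from the boundary and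
    \<open>1 + 2 * \<gamma> l\<close> from the bound
    \<open>ln (1 - \<gamma>) \<ge> - \<gamma> - 2 * \<gamma>^2\<close>. Giving up \<eta>/2 absorbs
    both.\<close>
  have "(\<lambda>l. (1 - \<eta>) * (1 + 8 / real l) * (1 + 2 * \<gamma> l)) \<longlonglongrightarrow> 1 - \<eta>"
    unfolding \<gamma>_def by real_asymp
  then have rate: "\<forall>\<^sub>F l in sequentially. (1 - \<eta>) * (1 + 8 / real l) * (1 + 2 * \<gamma> l) < 1 - \<eta> / 2"
    by (rule order_tendstoD) (use \<eta> in simp)
  have "\<gamma> \<longlonglongrightarrow> 0"
    unfolding \<gamma>_def by real_asymp
  then have small: "\<forall>\<^sub>F l in sequentially. \<gamma> l < 1 / 2"
    by (rule order_tendstoD) simp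
  have "filterlim (\<lambda>l::nat. exp (\<eta> * ln (real l))) at_top sequentially"
    using \<eta> by real_asymp
  then have large: "\<forall>\<^sub>F l in sequentially. C \<le> exp (\<eta> * ln (real l))"
    by (simp add: filterlim_at_top)
  show ?thesis
    using rate small large eventually_ge_at_top[of 2]
  proof eventually_elim
    case (elim l)
    have \<gamma>: "\<gamma> l > 0" using elim(4) unfolding \<gamma>_def by (intro mult_pos_pos divide_pos_pos add_pos_pos) auto
    have ln_l: "ln (real l) > 0" using elim(4) by simp
    have \<rho>_eq: "\<rho> l = 1 - \<gamma> l" by (simp add: \<rho>_def \<gamma>_def)
    have \<rho>_pos: "\<rho> l > 0" using elim(2) by (simp add: \<rho>_eq)
    have "C \<le> \<rho> l ^ (2 * t) * (real l)\<^sup>2"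
      if t: "real t \<le> (2 / pi\<^sup>2 - \<delta>) * real l ^ 4 * ln (real l)" for t
    proof -
      have "real t * (\<gamma> l * (1 + 2 * \<gamma> l)) \<le>
          (2 / pi\<^sup>2 - \<delta>) * real l ^ 4 * ln (real l) * (\<gamma> l * (1 + 2 * \<gamma> l))"
        using t \<gamma> by (intro mult_right_mono) auto
      also have "\<dots> = ln (real l) * ((2 / pi\<^sup>2 - \<delta>) * real l ^ 4 * (pi\<^sup>2 / (2 * real l ^ 4)) *
          (1 + 8 / real l) * (1 + 2 * \<gamma> l))"
        by (simp only: \<gamma>_def mult_ac)
      also have "(2 / pi\<^sup>2 - \<delta>) * real l ^ 4 * (pi\<^sup>2 / (2 * real l ^ 4)) = 1 - \<eta>"
        using elim(4) by (simp add: \<eta>_def field_simps)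
      also have "ln (real l) * ((1 - \<eta>) * (1 + 8 / real l) * (1 + 2 * \<gamma> l)) \<le> ln (real l) * (1 - \<eta> / 2)"
        using elim(1) ln_l by (intro mult_left_mono) auto
      finally have exponent: "real t * (\<gamma> l * (1 + 2 * \<gamma> l)) \<le> ln (real l) * (1 - \<eta> / 2)" .
      have "- (\<gamma> l * (1 + 2 * \<gamma> l)) \<le> ln (\<rho> l)"
        using ln_one_minus_pos_lower_bound[of "\<gamma> l"] \<gamma> elim(2)
        by (simp add: \<rho>_eq algebra_simps power2_eq_square)
      then have "real t * - (\<gamma> l * (1 + 2 * \<gamma> l)) \<le> real t * ln (\<rho> l)"
        by (intro mult_left_mono) auto
      \<comment> \<open>Doubling the exponent bound costs \<open>(2 - \<eta>) * ln l\<close> out of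
        the \<open>2 * ln l\<close> supplied by \<open>l^2\<close>.\<close>
      then have "\<eta> * ln (real l) \<le> 2 * real t * ln (\<rho> l) + 2 * ln (real l)"
        using exponent by (simp add: algebra_simps)
      then have "exp (\<eta> * ln (real l)) \<le> exp (2 * real t * ln (\<rho> l) + 2 * ln (real l))"
        by simp
      also have "\<dots> = exp (ln (\<rho> l ^ (2 * t) * (real l)\<^sup>2))"
        using \<rho>_pos elim(4) by (simp add: ln_mult ln_realpow)
      also have "\<dots> = \<rho> l ^ (2 * t) * (real l)\<^sup>2"
        using \<rho>_pos elim(4) by (intro exp_ln) auto
      finally show ?thesis using elim(3) by simp
    qed
    then show ?case using \<rho>_pos by simp
  qed
qed

theorem mainTheorem13:
  fixes \<epsilon> \<delta> :: real
  assumes "0 < \<epsilon>" and "\<epsilon> < 1" and "0 < \<delta>"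
  shows "\<exists>L::nat. \<forall>l\<ge>L. \<forall>t::nat.
    real t \<le> (2 / pi^2 - \<delta>) * real l ^ 4 * ln (real l) \<longrightarrow>
      worst_distance_from_uniform (vertex_driven_step l) (distinct_arrangements l) t \<ge> 1 - \<epsilon> \<and>
      worst_distance_from_uniform (vertex_driven_step l) (binary_arrangements l) t \<ge> 1 - \<epsilon>"
proof -
  define \<rho> where "\<rho> l = 1 - pi\<^sup>2 / (2 * real l ^ 4) * (1 + 8 / real l)" for l :: nat
  obtain L where L: "\<And>l. l \<ge> L \<Longrightarrow> 0 < \<rho> l \<and>
      (\<forall>t::nat. real t \<le> (2 / pi\<^sup>2 - \<delta>) * real l ^ 4 * ln (real l) \<longrightarrow>
        384 / \<epsilon> \<le> \<rho> l ^ (2 * t) * (real l)\<^sup>2)"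
    using eventually_power_ge[OF assms(3), of "384 / \<epsilon>"]
    unfolding \<rho>_def eventually_sequentially by blast
  show ?thesis
  \<comment> \<open>4 is the size from which the shuffle is known to be lazy; \<open>L\<close> comes
    from the target \<open>384 / \<epsilon>\<close>, which makes the error at most
    \<epsilon>.\<close>
  proof (intro exI[of _ "max L 4"] allI impI)
    fix l t :: nat
    assume l: "max L 4 \<le> l" and t: "real t \<le> (2 / pi\<^sup>2 - \<delta>) * real l ^ 4 * ln (real l)"
    have l4: "l \<ge> 4" and \<rho>: "\<rho> l > 0" and "384 / \<epsilon> \<le> \<rho> l ^ (2 * t) * (real l)\<^sup>2"
      using l t L[of l] by auto
    then have bound: "1 - \<epsilon> \<le> 1 - 384 / (\<rho> l ^ (2 * t) * (real l)\<^sup>2)"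
      using assms(1) by (simp add: field_simps)
    have "1 - 384 / (\<rho> l ^ (2 * t) * (real l)\<^sup>2) \<le>
        worst_distance_from_uniform (vertex_driven_step l) (distinct_arrangements l) t"
    proof (rule grid_worst_distance_ge[where \<phi> = "\<lambda>c. if c \<le> l\<^sup>2 div 2 then 1 else 0"])
      show "\<exists>s\<in>distinct_arrangements l. \<forall>x\<in>grid_vertices l.
          (if s x \<le> l\<^sup>2 div 2 then 1 else 0 :: real) = indicator A x"
        if "A \<subseteq> grid_vertices l" "card A = l\<^sup>2 div 2" for A
        using that by (rule distinct_arrangements_attain)
      show "(\<Sum>x\<in>grid_vertices l. if s x \<le> l\<^sup>2 div 2 then 1 else 0 :: real) = real (l\<^sup>2 div 2)"
        if "s \<in> distinct_arrangements l" for s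
        using that by (rule distinct_arrangements_sum) simp
    qed (use l4 \<rho> in \<open>simp_all add: \<rho>_def finite_distinct_arrangements distinct_arrangements_transpose\<close>)
    moreover have "1 - 384 / (\<rho> l ^ (2 * t) * (real l)\<^sup>2) \<le>
        worst_distance_from_uniform (vertex_driven_step l) (binary_arrangements l) t"
    proof (rule grid_worst_distance_ge[where \<phi> = "\<lambda>c. if c = 1 then 1 else 0"])
      show "\<exists>s\<in>binary_arrangements l. \<forall>x\<in>grid_vertices l.
          (if s x = 1 then 1 else 0 :: real) = indicator A x"
        if "A \<subseteq> grid_vertices l" "card A = l\<^sup>2 div 2" for A
        using that by (rule binary_arrangements_attain)
      show "(\<Sum>x\<in>grid_vertices l. if s x = 1 then 1 else 0 :: real) = real (l\<^sup>2 div 2)"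
        if "s \<in> binary_arrangements l" for s
        using that by (rule binary_arrangements_sum)
    qed (use l4 \<rho> in \<open>simp_all add: \<rho>_def finite_binary_arrangements binary_arrangements_transpose\<close>)
    ultimately show "1 - \<epsilon> \<le> worst_distance_from_uniform (vertex_driven_step l) (distinct_arrangements l) t \<and>
        1 - \<epsilon> \<le> worst_distance_from_uniform (vertex_driven_step l) (binary_arrangements l) t"
      using bound by linarith
  qed
qed

end
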